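(* Let $M$ be a paracompact smooth manifold, $\mathbb{A}$ a Weil algebra, and $M^{\mathbb{A}}$ the associated Weil bundle. Let $\mathcal{D}_{\mathbb{A}}(M^{\mathbb{A}})$ be the $C^{\infty}(M^{\mathbb{A}},\mathbb{A})$-module of $\mathbb{A}$-linear first order differential operators of $C^{\infty}(M^{\mathbb{A}},\mathbb{A})$. Then the map $$[\,\cdot,\cdot\,]:\mathcal{D}_{\mathbb{A}}(M^{\mathbb{A}})\times \mathcal{D}_{\mathbb{A}}(M^{\mathbb{A}})\longrightarrow \mathcal{D}_{\mathbb{A}}(M^{\mathbb{A}}),\qquad (X,Y)\longmapsto X\circ Y-Y\circ X,$$ is (well defined,) skew-symmetric and $\mathbb{A}$-bilinear, and defines a structure of $\mathbb{A}$-Lie algebra on $\mathcal{D}_{\mathbb{A}}(M^{\mathbb{A}})$. Furthermore, for all $\varphi\in C^{\infty}(M^{\mathbb{A}},\mathbb{A})$ and all $X,Y\in\mathcal{D}_{\mathbb{A}}(M^{\mathbb{A}})$, $$[X,\varphi\cdot Y]=\left[X(\varphi)-\varphi\cdot X(1_{C^{\infty}(M^{\mathbb{A}},\mathbb{A})})\right]\cdot Y+\varphi\cdot[X,Y].$$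
   Context: A Weil algebra $\mathbb{A}$ is a finite-dimensional associative commutative unital $\mathbb{R}$-algebra with a unique maximal ideal $\mathfrak{m}$, of codimension $1$, so $\mathbb{A}=\mathbb{R}\oplus\mathfrak{m}$ (with $\mathfrak{m}$ nilpotent). Let $M$ be a paracompact smooth ($C^\infty$) manifold of dimension $n$. A near point of $x\in M$ of kind $\mathbb{A}$ is a homomorphism of algebras $\xi:C^{\infty}(M)\to\mathbb{A}$ with $\xi(f)-f(x)\in\mathfrak{m}$ for all $f\in C^{\infty}(M)$. The Weil bundle $M^{\mathbb{A}}$ is the set of all near points of kind $\mathbb{A}$ of all points of $M$; it is a smooth manifold of dimension $n\cdot\dim\mathbb{A}$, with charts induced by local charts $(U;x_1,\dots,x_n)$ of $M$ via $U^{\mathbb{A}}\to\mathbb{A}^n$, $\xi\mapsto(\xi(x_1),\dots,\xi(x_n))$ (a bijection onto an open subset of $\mathbb{A}^n$). $C^{\infty}(M^{\mathbb{A}},\mathbb{A})$ is the commutative unital $\mathbb{A}$-algebra of smooth functions $M^{\mathbb{A}}\to\mathbb{A}$ with pointwise operations; its unit is $1_{C^{\infty}(M^{\mathbb{A}},\mathbb{A})}$. $\mathcal{D}_{\mathbb{A}}(M^{\mathbb{A}})$ is the set of $\mathbb{A}$-linear maps $X:C^{\infty}(M^{\mathbb{A}},\mathbb{A})\to C^{\infty}(M^{\mathbb{A}},\mathbb{A})$ such that $$X(\varphi\cdot\psi)=X(\varphi)\cdot\psi+\varphi\cdot X(\psi)-\varphi\cdot\psi\cdot X(1_{C^{\infty}(M^{\mathbb{A}},\mathbb{A})})\quad\text{for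 all }\varphi,\psi\in C^{\infty}(M^{\mathbb{A}},\mathbb{A}),$$ with module structure $(\varphi\cdot X)(\psi)=\varphi\cdot X(\psi)$. *)

theory Defs
  imports
    "HOL-Algebra.Module"
    "HOL-Algebra.Ideal"
    "HOL-Algebra.Algebraic_Closure_Type"
    "HOL-Analysis.Analysis"
begin

section \<open>Smooth manifolds\<close>

text \<open>\<open>n\<close>-space is \<^term>\<open>Euclidean_space n\<close>, the sequences vanishing from index
  \<open>n\<close> on. For open \<open>U\<close> the \<open>within\<close> below is the ordinary partial derivative, so
  \<open>f'\<close> is determined on \<open>U\<close>; the values of \<open>f\<close> outside \<open>U\<close> do not matter.\<close>

primrec Ck_on :: "nat \<Rightarrow> (nat \<Rightarrow> real) set \<Rightarrow> nat \<Rightarrow> ((nat \<Rightarrow> real) \<Rightarrow> real) \<Rightarrow> bool" where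
  "Ck_on n U 0 f \<longleftrightarrow>
     continuous_map (subtopology (Euclidean_space n) U) euclideanreal f"
| "Ck_on n U (Suc k) f \<longleftrightarrow>
     continuous_map (subtopology (Euclidean_space n) U) euclideanreal f \<and>
     (\<forall>i<n. \<exists>f'.
        (\<forall>x\<in>U. ((\<lambda>t. f (x(i := t))) has_real_derivative f' x)
                  (at (x i) within {t. x(i := t) \<in> U})) \<and>
        Ck_on n U k f')"

definition smooth_on :: "nat \<Rightarrow> (nat \<Rightarrow> real) set \<Rightarrow> ((nat \<Rightarrow> real) \<Rightarrow> real) \<Rightarrow> bool" where
  "smooth_on n U f \<longleftrightarrow> (\<forall>k. Ck_on n U k f)"

type_synonym 'p chart = "'p set \<times> ('p \<Rightarrow> nat \<Rightarrow> real)"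

definition smooth_manifold :: "nat \<Rightarrow> 'p topology \<Rightarrow> 'p chart set \<Rightarrow> bool" where
  "smooth_manifold n T \<A> \<longleftrightarrow>
     Hausdorff_space T \<and>
     (\<Union>(U, x)\<in>\<A>. U) = topspace T \<and>
     (\<forall>(U, x)\<in>\<A>.
        openin T U \<and>
        openin (Euclidean_space n) (x ` U) \<and>
        homeomorphic_map (subtopology T U) (subtopology (Euclidean_space n) (x ` U)) x) \<and>
     (\<forall>(U, x)\<in>\<A>. \<forall>(V, y)\<in>\<A>. \<forall>i<n.
        smooth_on n (x ` (U \<inter> V)) (\<lambda>q. y (inv_into U x q) i))"

definition paracompact_space :: "'p topology \<Rightarrow> bool" where
  "paracompact_space T \<longleftrightarrow>
     (\<forall>\<U>. (\<forall>U\<in>\<U>. openin T U) \<and> \<Union>\<U> = topspace T \<longrightarrow>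
        (\<exists>\<V>. (\<forall>V\<in>\<V>. openin T V) \<and> \<Union>\<V> = topspace T \<and>
             (\<forall>V\<in>\<V>. \<exists>U\<in>\<U>. V \<subseteq> U) \<and> locally_finite_in T \<V>))"

text \<open>Functions on a carrier set are \<^const>\<open>extensional\<close>, so that equality of functions is
  equality on the carrier.\<close>

definition smooth_functions :: "nat \<Rightarrow> 'p set \<Rightarrow> 'p chart set \<Rightarrow> ('p \<Rightarrow> real) set" where
  "smooth_functions n M \<A> =
     {f \<in> extensional M. \<forall>(U, x)\<in>\<A>. smooth_on n (x ` U) (f \<circ> inv_into U x)}"

definition pointwise_algebra ::
    "'p set \<Rightarrow> ('p \<Rightarrow> 'a::comm_ring_1) set \<Rightarrow> ('a, 'p \<Rightarrow> 'a) module" where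
  "pointwise_algebra M F =
     \<lparr>carrier = F,
      monoid.mult = (\<lambda>f g. \<lambda>p\<in>M. f p * g p),
      one = (\<lambda>p\<in>M. 1),
      ring.zero = (\<lambda>p\<in>M. 0),
      add = (\<lambda>f g. \<lambda>p\<in>M. f p + g p),
      module.smult = (\<lambda>c f. \<lambda>p\<in>M. c * f p)\<rparr>"

abbreviation smooth_algebra :: "nat \<Rightarrow> 'p set \<Rightarrow> 'p chart set \<Rightarrow> (real, 'p \<Rightarrow> real) module" where
  "smooth_algebra n M \<A> \<equiv> pointwise_algebra M (smooth_functions n M \<A>)"


section \<open>Weil algebras\<close>

text \<open>The algebra is the whole type. No norm is part of the structure: the reals are the only
  Weil algebra with a submultiplicative Euclidean norm for which the unit has norm 1, so
  \<^class>\<open>real_normed_algebra_1\<close> with \<^class>\<open>euclidean_space\<close> would exclude all others.\<close>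

definition weil_algebra :: "'a::{comm_ring_1, real_algebra_1} set \<Rightarrow> bool" where
  "weil_algebra \<mm> \<longleftrightarrow>
     (\<exists>B::'a set. finite B \<and> span B = UNIV) \<and>
     maximalideal \<mm> ring_of_type_algebra \<and>
     (\<forall>I. maximalideal I (ring_of_type_algebra :: 'a ring) \<longrightarrow> I = \<mm>) \<and>
     dim (UNIV :: 'a set) = dim \<mm> + 1"

definition weil_basis :: "'a::real_vector list" where
  "weil_basis = (SOME bs. distinct bs \<and> independent (set bs) \<and> span (set bs) = UNIV)"

text \<open>The linear isomorphism from \<open>n\<close>-tuples over the algebra, of real dimension \<open>d\<close>, to real
  \<open>(n * d)\<close>-space: coordinate \<open>i * d + j\<close> is the \<open>j\<close>-th coordinate of the \<open>i\<close>-th entry. Another basis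
  changes it by a linear automorphism, hence leaves smoothness unchanged.\<close>

definition weil_coordinates :: "nat \<Rightarrow> (nat \<Rightarrow> 'a::real_vector) \<Rightarrow> nat \<Rightarrow> real" where
  "weil_coordinates n a =
     (\<lambda>k. let d = dim (UNIV :: 'a set) in
        if k < n * d
        then representation (set weil_basis) (a (k div d)) (weil_basis ! (k mod d))
        else 0)"


section \<open>Weil bundles\<close>

definition weil_bundle ::
    "nat \<Rightarrow> 'p set \<Rightarrow> 'p chart set \<Rightarrow> 'a::{comm_ring_1, real_algebra_1} set
       \<Rightarrow> (('p \<Rightarrow> real) \<Rightarrow> 'a) set" where
  "weil_bundle n M \<A> \<mm> =
     {\<xi> \<in> extensional (smooth_functions n M \<A>).
        \<xi> \<in> ring_hom (smooth_algebra n M \<A>) ring_of_type_algebra \<and>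
        (\<forall>c. \<forall>f\<in>smooth_functions n M \<A>.
           \<xi> (c \<odot>\<^bsub>smooth_algebra n M \<A>\<^esub> f) = c *\<^sub>R \<xi> f) \<and>
        (\<exists>p\<in>M. \<forall>f\<in>smooth_functions n M \<A>. \<xi> f - of_real (f p) \<in> \<mm>)}"

text \<open>A near point of a chart domain \<open>U\<close>, itself a manifold with the single chart \<open>(U, x)\<close>,
  is a near point of \<open>M\<close> through restriction of functions. This is the identification of the
  Weil bundle of \<open>U\<close> with an open subset of that of \<open>M\<close>. The functions \<open>x\<^sub>i\<close> are smooth
  on \<open>U\<close> only, so their images are taken on the side of \<open>U\<close>.\<close>

definition weil_inclusion ::
    "nat \<Rightarrow> 'p set \<Rightarrow> 'p chart set \<Rightarrow> 'p set \<Rightarrow> (('p \<Rightarrow> real) \<Rightarrow> 'a) \<Rightarrow> ('p \<Rightarrow> real) \<Rightarrow> 'a" where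
  "weil_inclusion n M \<A> U \<eta> = (\<lambda>f\<in>smooth_functions n M \<A>. \<eta> (restrict f U))"

definition weil_chart ::
    "nat \<Rightarrow> 'p set \<Rightarrow> 'p chart set \<Rightarrow> 'a::{comm_ring_1, real_algebra_1} set
       \<Rightarrow> 'p chart \<Rightarrow> (('p \<Rightarrow> real) \<Rightarrow> 'a) chart" where
  "weil_chart n M \<A> \<mm> = (\<lambda>(U, x).
     let B = weil_bundle n U {(U, x)} \<mm>; \<iota> = weil_inclusion n M \<A> U
     in (\<iota> ` B,
         \<lambda>\<xi>. weil_coordinates n (\<lambda>i. inv_into B \<iota> \<xi> (\<lambda>p\<in>U. x p i))))"

text \<open>An algebra-valued function is smooth iff all its compositions with real linear functionals
  are.\<close>

definition weil_smooth_functions ::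
    "nat \<Rightarrow> 'p set \<Rightarrow> 'p chart set \<Rightarrow> 'a::{comm_ring_1, real_algebra_1} set
       \<Rightarrow> ((('p \<Rightarrow> real) \<Rightarrow> 'a) \<Rightarrow> 'a) set" where
  "weil_smooth_functions n M \<A> \<mm> =
     {\<phi> \<in> extensional (weil_bundle n M \<A> \<mm>).
        \<forall>l :: 'a \<Rightarrow> real. linear l \<longrightarrow>
          (\<lambda>\<xi>\<in>weil_bundle n M \<A> \<mm>. l (\<phi> \<xi>))
            \<in> smooth_functions (n * dim (UNIV :: 'a set)) (weil_bundle n M \<A> \<mm>)
                (weil_chart n M \<A> \<mm> ` \<A>)}"

definition weil_smooth_algebra ::
    "nat \<Rightarrow> 'p set \<Rightarrow> 'p chart set \<Rightarrow> 'a::{comm_ring_1, real_algebra_1} set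
       \<Rightarrow> ('a, (('p \<Rightarrow> real) \<Rightarrow> 'a) \<Rightarrow> 'a) module" where
  "weil_smooth_algebra n M \<A> \<mm> =
     pointwise_algebra (weil_bundle n M \<A> \<mm>) (weil_smooth_functions n M \<A> \<mm>)"


section \<open>First order differential operators and Lie algebras\<close>

definition diff_ops ::
    "('r, 'm) ring_scheme \<Rightarrow> ('r, 'f, 'n) module_scheme \<Rightarrow> ('f \<Rightarrow> 'f) set" where
  "diff_ops R C =
     {P \<in> carrier C \<rightarrow>\<^sub>E carrier C.
        (\<forall>\<phi>\<in>carrier C. \<forall>\<psi>\<in>carrier C. P (\<phi> \<oplus>\<^bsub>C\<^esub> \<psi>) = P \<phi> \<oplus>\<^bsub>C\<^esub> P \<psi>) \<and>
        (\<forall>a\<in>carrier R. \<forall>\<phi>\<in>carrier C. P (a \<odot>\<^bsub>C\<^esub> \<phi>) = a \<odot>\<^bsub>C\<^esub> P \<phi>) \<and>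
        (\<forall>\<phi>\<in>carrier C. \<forall>\<psi>\<in>carrier C.
           P (\<phi> \<otimes>\<^bsub>C\<^esub> \<psi>) =
             (P \<phi> \<otimes>\<^bsub>C\<^esub> \<psi> \<oplus>\<^bsub>C\<^esub> \<phi> \<otimes>\<^bsub>C\<^esub> P \<psi>) \<ominus>\<^bsub>C\<^esub> \<phi> \<otimes>\<^bsub>C\<^esub> \<psi> \<otimes>\<^bsub>C\<^esub> P \<one>\<^bsub>C\<^esub>)}"

text \<open>The scalars \<open>'s\<close> act on values through \<open>act\<close>: with \<open>act = (\<odot>)\<close> of \<open>C\<close> this is the module
  over \<open>R\<close>, with \<open>act = (\<otimes>)\<close> of \<open>C\<close> the module over \<open>C\<close> itself. The ring multiplication of a
  module record is irrelevant.\<close>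

definition diff_op_module ::
    "('s \<Rightarrow> 'f \<Rightarrow> 'f) \<Rightarrow> ('r, 'm) ring_scheme \<Rightarrow> ('r, 'f, 'n) module_scheme
       \<Rightarrow> ('s, 'f \<Rightarrow> 'f) module" where
  "diff_op_module act R C =
     \<lparr>carrier = diff_ops R C,
      monoid.mult = undefined,
      one = undefined,
      ring.zero = (\<lambda>\<phi>\<in>carrier C. \<zero>\<^bsub>C\<^esub>),
      add = (\<lambda>P Q. \<lambda>\<phi>\<in>carrier C. P \<phi> \<oplus>\<^bsub>C\<^esub> Q \<phi>),
      module.smult = (\<lambda>s P. \<lambda>\<phi>\<in>carrier C. act s (P \<phi>))\<rparr>"

definition commutator ::
    "('f, 'n) ring_scheme \<Rightarrow> ('f \<Rightarrow> 'f) \<Rightarrow> ('f \<Rightarrow> 'f) \<Rightarrow> 'f \<Rightarrow> 'f" where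
  "commutator C P Q = (\<lambda>\<phi>\<in>carrier C. P (Q \<phi>) \<ominus>\<^bsub>C\<^esub> Q (P \<phi>))"

locale lie_algebra = Module.module R L
  for R :: "('r, 'm) ring_scheme" (structure) and L :: "('r, 'l, 'n) module_scheme" (structure) +
  fixes br :: "'l \<Rightarrow> 'l \<Rightarrow> 'l"
  assumes br_closed: "\<lbrakk>x \<in> carrier L; y \<in> carrier L\<rbrakk> \<Longrightarrow> br x y \<in> carrier L"
    and br_add_left: "\<lbrakk>x \<in> carrier L; y \<in> carrier L; z \<in> carrier L\<rbrakk>
      \<Longrightarrow> br (x \<oplus>\<^bsub>L\<^esub> y) z = br x z \<oplus>\<^bsub>L\<^esub> br y z"
    and br_add_right: "\<lbrakk>x \<in> carrier L; y \<in> carrier L; z \<in> carrier L\<rbrakk>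
      \<Longrightarrow> br x (y \<oplus>\<^bsub>L\<^esub> z) = br x y \<oplus>\<^bsub>L\<^esub> br x z"
    and br_smult_left: "\<lbrakk>a \<in> carrier R; x \<in> carrier L; y \<in> carrier L\<rbrakk>
      \<Longrightarrow> br (a \<odot>\<^bsub>L\<^esub> x) y = a \<odot>\<^bsub>L\<^esub> br x y"
    and br_smult_right: "\<lbrakk>a \<in> carrier R; x \<in> carrier L; y \<in> carrier L\<rbrakk>
      \<Longrightarrow> br x (a \<odot>\<^bsub>L\<^esub> y) = a \<odot>\<^bsub>L\<^esub> br x y"
    and br_alternating: "x \<in> carrier L \<Longrightarrow> br x x = \<zero>\<^bsub>L\<^esub>"
    and br_jacobi: "\<lbrakk>x \<in> carrier L; y \<in> carrier L; z \<in> carrier L\<rbrakk>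
      \<Longrightarrow> br x (br y z) \<oplus>\<^bsub>L\<^esub> br y (br z x) \<oplus>\<^bsub>L\<^esub> br z (br x y) = \<zero>\<^bsub>L\<^esub>"

end

theory Submission
  imports Defs
begin

text \<open>
  The statement has an algebraic and an analytic half.

  Algebraically, let \<open>C\<close> be a commutative algebra over \<open>A\<close>. For a first order operator \<open>P\<close> put
  \<open>p \<phi> = P \<phi> - \<phi> P 1\<close>, its symbol. The defining rule says \<open>P (\<phi>\<psi>) = p \<phi> \<psi> + \<phi> P \<psi>\<close>
  (\<open>diff_op_mult\<close>), and conversely a rule of this shape, with some \<open>p\<close>, makes \<open>P\<close> a first
  order operator (\<open>diff_opsI\<close>). Expanding \<open>P (Q (\<phi>\<psi>))\<close> by this rule, the terms in which
  one operator acts on \<open>\<phi>\<close> and the other on \<open>\<psi>\<close> are together symmetric in \<open>P\<close> and \<open>Q\<close>. They cancel in the commutator,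
  which therefore is again a first order operator (\<open>commutator_closed\<close>). The formula for
  \<open>[P, \<phi> Q]\<close> is the same rule applied to \<open>P (\<phi> Q \<psi>)\<close> (\<open>commutator_leibniz\<close>). The Lie algebra
  axioms hold for commutators of linear maps in general (\<open>commutator_lie_algebra\<close>), and
  skew-symmetry follows from them.

  Analytically, it has to be seen that the smooth functions on the Weil bundle with values in the Weil
  algebra are such a \<open>C\<close>, that is, contain the constants and are closed under sums and products.
  Smoothness is defined by composition with linear functionals; a functional of a product is, in
  a basis of the finite-dimensional Weil algebra, a polynomial in coordinates of the factors
  (\<open>smooth_vector_functions_mult\<close>), so that real smooth functions and the product rule suffice.
  Constants are smooth because the chart domains of the Weil bundle do lie inside it
  (\<open>weil_charts_in\<close>).
\<close>

section \<open>Smooth functions on an atlas\<close>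

text \<open>Smoothness on \<open>U\<close> is a property of the values on \<open>U\<close>: a difference quotient within
  \<open>{t. x(i := t) \<in> U}\<close> evaluates the function at points of \<open>U\<close> only.\<close>

lemma Ck_on_cong:
  "(\<And>x. x \<in> U \<Longrightarrow> f x = g x) \<Longrightarrow> Ck_on n U k f \<Longrightarrow> Ck_on n U k g"
proof (induction k arbitrary: f g)
  case 0
  then show ?case
    by (auto intro: continuous_map_eq)
next
  case (Suc k)
  have *: "((\<lambda>t. g (x(i := t))) has_real_derivative f' x) (at (x i) within {t. x(i := t) \<in> U})"
    if "x \<in> U" "((\<lambda>t. f (x(i := t))) has_real_derivative f' x) (at (x i) within {t. x(i := t) \<in> U})"
    for x i f'
    by (rule has_field_derivative_transform_within[OF that(2) zero_less_one]) (use that(1) Suc.prems(1) in auto)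
  then show ?case
    unfolding Ck_on.simps
  proof (intro conjI allI impI)
    show "continuous_map (subtopology (Euclidean_space n) U) euclideanreal g"
      using Suc.prems by (auto intro: continuous_map_eq)
    fix i assume "i < n"
    then obtain f' where f': "Ck_on n U k f'"
      "\<forall>x\<in>U. ((\<lambda>t. f (x(i := t))) has_real_derivative f' x) (at (x i) within {t. x(i := t) \<in> U})"
      using Suc.prems(2) by auto
    show "\<exists>f'. (\<forall>x\<in>U. ((\<lambda>t. g (x(i := t))) has_real_derivative f' x)
        (at (x i) within {t. x(i := t) \<in> U})) \<and> Ck_on n U k f'"
      using f' * by (intro exI[of _ f']) simp
  qed
qed

text \<open>The product rule multiplies a derivative, of class \<open>C\<^sup>k\<close>, by the other factor, known to be
  of class \<open>C\<^sup>k\<^sup>+\<^sup>1\<close>. The induction for products needs both in the same class.\<close>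

lemma Ck_on_SucD: "Ck_on n U (Suc k) f \<Longrightarrow> Ck_on n U k f"
proof (induction k arbitrary: f)
  case (Suc k)
  then show ?case by (metis Ck_on.simps(2))
qed simp

lemma Ck_on_const: "Ck_on n U k (\<lambda>_. c)"
proof (induction k arbitrary: c)
  case (Suc k)
  then show ?case
    by (auto intro!: exI[of _ "\<lambda>_. 0"])
qed simp

lemma Ck_on_add:
  "Ck_on n U k f \<Longrightarrow> Ck_on n U k g \<Longrightarrow> Ck_on n U k (\<lambda>x. f x + g x)"
proof (induction k arbitrary: f g)
  case (Suc k)
  show ?case
    unfolding Ck_on.simps
  proof (intro conjI allI impI)
    fix i assume "i < n"
    with Suc.prems obtain f' g' where
      "\<forall>x\<in>U. ((\<lambda>t. f (x(i := t))) has_real_derivative f' x) (at (x i) within {t. x(i := t) \<in> U})" "Ck_on n U k f'"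
      "\<forall>x\<in>U. ((\<lambda>t. g (x(i := t))) has_real_derivative g' x) (at (x i) within {t. x(i := t) \<in> U})" "Ck_on n U k g'"
      by (metis Ck_on.simps(2))
    then show "\<exists>h. (\<forall>x\<in>U. ((\<lambda>t. f (x(i := t)) + g (x(i := t))) has_real_derivative h x)
        (at (x i) within {t. x(i := t) \<in> U})) \<and> Ck_on n U k h"
      using Suc.IH by (intro exI[of _ "\<lambda>x. f' x + g' x"]) (auto intro: DERIV_add)
  qed (use Suc.prems in \<open>auto intro: continuous_map_add\<close>)
qed (auto intro: continuous_map_add)

lemma Ck_on_mult:
  "Ck_on n U k f \<Longrightarrow> Ck_on n U k g \<Longrightarrow> Ck_on n U k (\<lambda>x. f x * g x)"
proof (induction k arbitrary: f g)
  case (Suc k)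
  show ?case
    unfolding Ck_on.simps
  proof (intro conjI allI impI)
    fix i assume "i < n"
    with Suc.prems obtain f' g' where fg:
      "\<forall>x\<in>U. ((\<lambda>t. f (x(i := t))) has_real_derivative f' x) (at (x i) within {t. x(i := t) \<in> U})" "Ck_on n U k f'"
      "\<forall>x\<in>U. ((\<lambda>t. g (x(i := t))) has_real_derivative g' x) (at (x i) within {t. x(i := t) \<in> U})" "Ck_on n U k g'"
      by (metis Ck_on.simps(2))
    have "((\<lambda>t. f (x(i := t)) * g (x(i := t))) has_real_derivative f' x * g x + g' x * f x)
        (at (x i) within {t. x(i := t) \<in> U})" if "x \<in> U" for x
      using DERIV_mult[OF fg(1)[rule_format, OF that] fg(3)[rule_format, OF that]] by simp
    moreover have "Ck_on n U k (\<lambda>x. f' x * g x + g' x * f x)"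
      by (rule Ck_on_add[OF Suc.IH[OF fg(2) Ck_on_SucD[OF Suc.prems(2)]]
            Suc.IH[OF fg(4) Ck_on_SucD[OF Suc.prems(1)]]])
    ultimately show "\<exists>h. (\<forall>x\<in>U. ((\<lambda>t. f (x(i := t)) * g (x(i := t))) has_real_derivative h x)
        (at (x i) within {t. x(i := t) \<in> U})) \<and> Ck_on n U k h"
      by (intro exI[of _ "\<lambda>x. f' x * g x + g' x * f x"]) simp
  qed (use Suc.prems in \<open>simp add: continuous_map_real_mult\<close>)
qed (simp add: continuous_map_real_mult)

lemma smooth_on_cong:
  "(\<And>x. x \<in> U \<Longrightarrow> f x = g x) \<Longrightarrow> smooth_on n U f \<Longrightarrow> smooth_on n U g"
  unfolding smooth_on_def using Ck_on_cong[of U f g] by simp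

lemma smooth_on_const: "smooth_on n U (\<lambda>_. c)"
  by (simp add: smooth_on_def Ck_on_const)

lemma smooth_on_add:
  "smooth_on n U f \<Longrightarrow> smooth_on n U g \<Longrightarrow> smooth_on n U (\<lambda>x. f x + g x)"
  by (simp add: smooth_on_def Ck_on_add)

lemma smooth_on_mult:
  "smooth_on n U f \<Longrightarrow> smooth_on n U g \<Longrightarrow> smooth_on n U (\<lambda>x. f x * g x)"
  by (simp add: smooth_on_def Ck_on_mult)

text \<open>The value of a restricted function outside its carrier is \<^const>\<open>undefined\<close>, so even the
  restriction of a constant could fail to be smooth along a chart that leaves the carrier.\<close>

definition charts_in :: "'p set \<Rightarrow> 'p chart set \<Rightarrow> bool" where
  "charts_in M \<A> \<longleftrightarrow> (\<forall>(U, x)\<in>\<A>. U \<subseteq> M)"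

lemma smooth_functionsI:
  assumes "charts_in M \<A>"
    and "\<And>U x. (U, x) \<in> \<A> \<Longrightarrow> smooth_on n (x ` U) (\<lambda>q. f (inv_into U x q))"
  shows "(\<lambda>p\<in>M. f p) \<in> smooth_functions n M \<A>"
proof -
  have "smooth_on n (x ` U) ((\<lambda>p\<in>M. f p) \<circ> inv_into U x)" if "(U, x) \<in> \<A>" for U x
  proof (rule smooth_on_cong[OF _ assms(2)[OF that]])
    fix q assume "q \<in> x ` U"
    then have "inv_into U x q \<in> M"
      using assms(1) that inv_into_into[of q x U] by (auto simp: charts_in_def)
    then show "f (inv_into U x q) = ((\<lambda>p\<in>M. f p) \<circ> inv_into U x) q"
      by simp
  qed
  then show ?thesis
    by (auto simp: smooth_functions_def)
qed

lemma smooth_functions_const: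
  "charts_in M \<A> \<Longrightarrow> (\<lambda>p\<in>M. c) \<in> smooth_functions n M \<A>"
  by (rule smooth_functionsI) (auto intro: smooth_on_const)

lemma smooth_functions_add:
  assumes A: "charts_in M \<A>" and f: "f \<in> smooth_functions n M \<A>" and g: "g \<in> smooth_functions n M \<A>"
  shows "(\<lambda>p\<in>M. f p + g p) \<in> smooth_functions n M \<A>"
proof (rule smooth_functionsI[OF A])
  fix U x assume "(U, x) \<in> \<A>"
  then have "smooth_on n (x ` U) (f \<circ> inv_into U x)" "smooth_on n (x ` U) (g \<circ> inv_into U x)"
    using f g by (auto simp: smooth_functions_def)
  then show "smooth_on n (x ` U) (\<lambda>q. f (inv_into U x q) + g (inv_into U x q))"
    unfolding comp_def by (rule smooth_on_add)
qed

lemma smooth_functions_mult: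
  assumes A: "charts_in M \<A>" and f: "f \<in> smooth_functions n M \<A>" and g: "g \<in> smooth_functions n M \<A>"
  shows "(\<lambda>p\<in>M. f p * g p) \<in> smooth_functions n M \<A>"
proof (rule smooth_functionsI[OF A])
  fix U x assume "(U, x) \<in> \<A>"
  then have "smooth_on n (x ` U) (f \<circ> inv_into U x)" "smooth_on n (x ` U) (g \<circ> inv_into U x)"
    using f g by (auto simp: smooth_functions_def)
  then show "smooth_on n (x ` U) (\<lambda>q. f (inv_into U x q) * g (inv_into U x q))"
    unfolding comp_def by (rule smooth_on_mult)
qed

lemma smooth_functions_sum:
  assumes "charts_in M \<A>" and "finite I"
    and "\<And>i. i \<in> I \<Longrightarrow> (\<lambda>p\<in>M. f i p) \<in> smooth_functions n M \<A>"
  shows "(\<lambda>p\<in>M. \<Sum>i\<in>I. f i p) \<in> smooth_functions n M \<A>"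
  using assms(2,3)
proof (induction I)
  case empty
  then show ?case
    unfolding sum.empty by (intro smooth_functions_const[OF assms(1)])
next
  case (insert i I)
  have "(\<lambda>p\<in>M. (\<lambda>p\<in>M. f i p) p + (\<lambda>p\<in>M. \<Sum>i\<in>I. f i p) p) \<in> smooth_functions n M \<A>"
    using insert by (intro smooth_functions_add[OF assms(1)]) auto
  then show ?case
    unfolding sum.insert[OF insert.hyps] by (simp add: restrict_def cong: if_cong)
qed

section \<open>The charts of a Weil bundle\<close>

lemma restrict_smooth_functions:
  assumes "(U, x) \<in> \<A>" "f \<in> smooth_functions n M \<A>"
  shows "restrict f U \<in> smooth_functions n U {(U, x)}"
  using assms by (intro smooth_functionsI) (auto simp: charts_in_def smooth_functions_def comp_def)

text \<open>Near points of \<open>U\<close> become near points of \<open>M\<close> because restricting functions from \<open>M\<close> to \<open>U\<close> is a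
  unital homomorphism of real algebras that keeps the values at the points of \<open>U\<close>, and near points
  are composed with it.\<close>

lemma weil_inclusion_in_weil_bundle:
  fixes \<eta> :: "('p \<Rightarrow> real) \<Rightarrow> 'a::{comm_ring_1, real_algebra_1}"
  assumes M: "charts_in M \<A>" and U: "(U, x) \<in> \<A>" and \<eta>: "\<eta> \<in> weil_bundle n U {(U, x)} \<mm>"
  shows "weil_inclusion n M \<A> U \<eta> \<in> weil_bundle n M \<A> \<mm>"
proof -
  let ?F = "smooth_functions n M \<A>" and ?G = "smooth_functions n U {(U, x)}"
  have UM: "U \<subseteq> M" using M U by (auto simp: charts_in_def)
  have res: "restrict f U \<in> ?G" if "f \<in> ?F" for f
    using restrict_smooth_functions[OF U that] .
  have MU: "M \<inter> U = U" using UM by blast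
  have "\<eta> (\<lambda>p\<in>U. f p + g p) = \<eta> f + \<eta> g" "\<eta> (\<lambda>p\<in>U. f p * g p) = \<eta> f * \<eta> g"
     "\<eta> (\<lambda>p\<in>U. c * f p) = c *\<^sub>R \<eta> f"
    if "f \<in> ?G" "g \<in> ?G" for f g c
    using \<eta> that by (auto simp: weil_bundle_def ring_hom_def pointwise_algebra_def ring_of_type_algebra_def)
  note this[OF res res]
  then have hom: "\<eta> (\<lambda>p\<in>U. f p + g p) = \<eta> (restrict f U) + \<eta> (restrict g U)"
     "\<eta> (\<lambda>p\<in>U. f p * g p) = \<eta> (restrict f U) * \<eta> (restrict g U)"
     "\<eta> (\<lambda>p\<in>U. c * f p) = c *\<^sub>R \<eta> (restrict f U)"
    if "f \<in> ?F" "g \<in> ?F" for f g c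
    using that by (simp_all cong: restrict_cong)
  have one: "\<eta> (\<lambda>p\<in>U. 1) = 1"
    using \<eta> by (auto simp: weil_bundle_def ring_hom_def pointwise_algebra_def ring_of_type_algebra_def)
  obtain p where p: "p \<in> U" "\<And>f. f \<in> ?G \<Longrightarrow> \<eta> f - of_real (f p) \<in> \<mm>"
    using \<eta> by (auto simp: weil_bundle_def)
  show ?thesis
    unfolding weil_bundle_def
  proof (intro CollectI conjI allI ballI bexI[of _ p])
    show "weil_inclusion n M \<A> U \<eta> \<in> ring_hom (smooth_algebra n M \<A>) ring_of_type_algebra"
      using smooth_functions_add[OF M] smooth_functions_mult[OF M] smooth_functions_const[OF M]
      by (auto simp: ring_hom_def pointwise_algebra_def ring_of_type_algebra_def weil_inclusion_def MU hom one)
    show "weil_inclusion n M \<A> U \<eta> (c \<odot>\<^bsub>smooth_algebra n M \<A>\<^esub> f) = c *\<^sub>R weil_inclusion n M \<A> U \<eta> f"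
      if "f \<in> ?F" for c f
    proof -
      have "(\<lambda>p\<in>M. c * f p) \<in> ?F"
        using smooth_functions_mult[OF M smooth_functions_const[OF M, of c] that]
        by (simp cong: restrict_cong)
      then show ?thesis
        using that by (simp add: pointwise_algebra_def weil_inclusion_def MU hom)
    qed
    show "weil_inclusion n M \<A> U \<eta> f - of_real (f p) \<in> \<mm>" if "f \<in> ?F" for f
      using that p res[OF that] by (force simp: weil_inclusion_def)
    show "p \<in> M" using p UM by auto
  qed (simp add: weil_inclusion_def)
qed

text \<open>Thus constants are smooth on the Weil bundle, and the closure properties of smooth functions
  apply to it.\<close>

lemma weil_charts_in:
  assumes "charts_in M \<A>"
  shows "charts_in (weil_bundle n M \<A> \<mm>) (weil_chart n M \<A> \<mm> ` \<A>)"
  using weil_inclusion_in_weil_bundle[OF assms]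
  by (auto simp: charts_in_def weil_chart_def Let_def)

section \<open>The algebra of smooth algebra-valued functions\<close>

text \<open>The description of algebra-valued smooth functions by real linear functionals, for an arbitrary
  carrier and atlas; on a Weil bundle it is \<^const>\<open>weil_smooth_functions\<close>.\<close>

definition smooth_vector_functions ::
  "nat \<Rightarrow> 'p set \<Rightarrow> 'p chart set \<Rightarrow> ('p \<Rightarrow> 'a::real_vector) set" where
  "smooth_vector_functions n M \<A> =
     {\<phi> \<in> extensional M. \<forall>l. linear l \<longrightarrow> (\<lambda>p\<in>M. l (\<phi> p)) \<in> smooth_functions n M \<A>}"

lemma weil_smooth_functions_eq:
  "weil_smooth_functions n M \<A> \<mm> =
     smooth_vector_functions (n * dim (UNIV :: 'a::{comm_ring_1, real_algebra_1} set))
       (weil_bundle n M \<A> (\<mm> :: 'a set)) (weil_chart n M \<A> \<mm> ` \<A>)"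
  by (simp add: weil_smooth_functions_def smooth_vector_functions_def)

text \<open>A linear functional of a product is a bilinear function of the factors, hence in finite dimension
  a finite sum of constants times products of coordinates. The coordinates are linear
  functionals of the factors, and therefore smooth.\<close>

lemma smooth_vector_functions_mult:
  fixes \<phi> \<psi> :: "'p \<Rightarrow> 'a::real_algebra" and B :: "'a set"
  assumes A: "charts_in M \<A>" and B: "finite B" "span B = UNIV"
   and "\<phi> \<in> smooth_vector_functions n M \<A>" "\<psi> \<in> smooth_vector_functions n M \<A>"
  shows "(\<lambda>p\<in>M. \<phi> p * \<psi> p) \<in> smooth_vector_functions n M \<A>"
proof -
  obtain E :: "'a set" where "independent E" and "UNIV \<subseteq> span E"
    by (meson maximal_independent_subset)
  then have E: "independent E" "span E = UNIV" by auto
  have fin: "finite E"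
    using independent_span_bound[OF B(1) E(1)] B(2) by simp
  define r where "r b v = representation E v b" for b v
  have lin: "linear (r b)" for b
    by (rule linearI) (simp_all add: r_def representation_add representation_scale E)
  have coords: "v = (\<Sum>b\<in>E. r b v *\<^sub>R b)" for v
    by (simp add: r_def sum_representation_eq E fin)
  have sm: "(\<lambda>p\<in>M. r b (\<phi> p)) \<in> smooth_functions n M \<A>" "(\<lambda>p\<in>M. r b (\<psi> p)) \<in> smooth_functions n M \<A>" for b
    using assms(4,5) lin unfolding smooth_vector_functions_def by blast+
  have "(\<lambda>p\<in>M. l (\<phi> p * \<psi> p)) \<in> smooth_functions n M \<A>" if l: "linear l" for l :: "'a \<Rightarrow> real"
  proof -
    have bilinear: "l (v * w) = (\<Sum>b\<in>E. \<Sum>c\<in>E. (l (b * c) * r b v) * r c w)" for v w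
    proof -
      have "v * w = (\<Sum>b\<in>E. \<Sum>c\<in>E. (r b v * r c w) *\<^sub>R (b * c))"
        by (subst coords[of v], subst coords[of w]) (simp add: sum_product mult.commute)
      then show ?thesis
        by (simp add: linear_sum[OF l] linear_scale[OF l] mult_ac)
    qed
    have "(\<lambda>p\<in>M. (l (b * c) * r b (\<phi> p)) * r c (\<psi> p)) \<in> smooth_functions n M \<A>" for b c
      using smooth_functions_mult[OF A smooth_functions_mult[OF A smooth_functions_const[OF A] sm(1)]
          sm(2), of "l (b * c)" b c]
      by (simp cong: restrict_cong)
    then have "(\<lambda>p\<in>M. \<Sum>b\<in>E. \<Sum>c\<in>E. (l (b * c) * r b (\<phi> p)) * r c (\<psi> p)) \<in> smooth_functions n M \<A>"
      by (intro smooth_functions_sum[OF A fin])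
    then show ?thesis
      by (subst bilinear)
  qed
  then show ?thesis
    by (simp add: smooth_vector_functions_def cong: restrict_cong)
qed

lemma smooth_vector_functions_add:
  assumes A: "charts_in M \<A>"
   and "\<phi> \<in> smooth_vector_functions n M \<A>" "\<psi> \<in> smooth_vector_functions n M \<A>"
  shows "(\<lambda>p\<in>M. \<phi> p + \<psi> p) \<in> smooth_vector_functions n M \<A>"
proof -
  have "(\<lambda>p\<in>M. l (\<phi> p + \<psi> p)) \<in> smooth_functions n M \<A>" if l: "linear l" for l
    using smooth_functions_add[OF A, of "\<lambda>p\<in>M. l (\<phi> p)" n "\<lambda>p\<in>M. l (\<psi> p)"] assms(2,3) l
    by (simp add: smooth_vector_functions_def linear_add cong: restrict_cong)
  then show ?thesis
    by (simp add: smooth_vector_functions_def cong: restrict_cong)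
qed

lemma smooth_vector_functions_const:
  assumes A: "charts_in M \<A>"
  shows "(\<lambda>p\<in>M. c) \<in> smooth_vector_functions n M \<A>"
  using smooth_functions_const[OF A]
  by (simp add: smooth_vector_functions_def cong: restrict_cong)

text \<open>Scalar multiples and negatives are products with constant functions, so closure under sums and
  products is enough.\<close>

lemma algebra_pointwise:
  fixes F :: "('p \<Rightarrow> 'a::comm_ring_1) set"
  assumes ext: "F \<subseteq> extensional M"
    and const: "\<And>c. (\<lambda>p\<in>M. c) \<in> F"
    and add: "\<And>f g. f \<in> F \<Longrightarrow> g \<in> F \<Longrightarrow> (\<lambda>p\<in>M. f p + g p) \<in> F"
    and mult: "\<And>f g. f \<in> F \<Longrightarrow> g \<in> F \<Longrightarrow> (\<lambda>p\<in>M. f p * g p) \<in> F"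
  shows "Module.algebra (ring_of_type_algebra :: 'a ring) (pointwise_algebra M F)"
proof -
  have smult: "(\<lambda>p\<in>M. c * f p) \<in> F" if "f \<in> F" for c f
    using mult[OF const[of c] that] by (simp cong: restrict_cong)
  have eq: "(\<lambda>p\<in>M. f p) = f" if "f \<in> F" for f
    using ext that by (auto simp: extensional_restrict)
  note d = pointwise_algebra_def ring_of_type_algebra_def
  have "abelian_group (pointwise_algebra M F)"
  proof (rule abelian_groupI)
    fix f assume "f \<in> carrier (pointwise_algebra M F)"
    then have "f \<in> F" by (simp add: d)
    then show "\<exists>g\<in>carrier (pointwise_algebra M F). g \<oplus>\<^bsub>pointwise_algebra M F\<^esub> f = \<zero>\<^bsub>pointwise_algebra M F\<^esub>"
      using smult[of f "-1"] by (intro bexI[of _ "\<lambda>p\<in>M. -1 * f p"]) (auto simp: d cong: restrict_cong)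
  qed (auto simp: d add const eq algebra_simps cong: restrict_cong)
  moreover have "comm_monoid (pointwise_algebra M F)"
    by unfold_locales (auto simp: d mult const eq algebra_simps cong: restrict_cong)
  ultimately have "cring (pointwise_algebra M F)"
    by (intro cringI) (auto simp: d algebra_simps cong: restrict_cong)
  then show ?thesis
    using cring_from_type_algebra \<open>abelian_group _\<close>
    by (intro algebraI) (auto simp: d smult eq algebra_simps cong: restrict_cong)
qed

section \<open>First order operators and their symbols\<close>

lemma (in Module.algebra) diff_opsD:
  assumes "P \<in> diff_ops R M"
  shows "\<phi> \<in> carrier M \<Longrightarrow> P \<phi> \<in> carrier M"
    and "P \<in> extensional (carrier M)"
    and "\<lbrakk>\<phi> \<in> carrier M; \<psi> \<in> carrier M\<rbrakk> \<Longrightarrow> P (\<phi> \<oplus>\<^bsub>M\<^esub> \<psi>) = P \<phi> \<oplus>\<^bsub>M\<^esub> P \<psi>"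
    and "\<lbrakk>a \<in> carrier R; \<phi> \<in> carrier M\<rbrakk> \<Longrightarrow> P (a \<odot>\<^bsub>M\<^esub> \<phi>) = a \<odot>\<^bsub>M\<^esub> P \<phi>"
    and "\<lbrakk>\<phi> \<in> carrier M; \<psi> \<in> carrier M\<rbrakk> \<Longrightarrow> P (\<phi> \<otimes>\<^bsub>M\<^esub> \<psi>) =
       (P \<phi> \<otimes>\<^bsub>M\<^esub> \<psi> \<oplus>\<^bsub>M\<^esub> \<phi> \<otimes>\<^bsub>M\<^esub> P \<psi>) \<ominus>\<^bsub>M\<^esub> \<phi> \<otimes>\<^bsub>M\<^esub> \<psi> \<otimes>\<^bsub>M\<^esub> P \<one>\<^bsub>M\<^esub>"
  using assms by (auto simp: diff_ops_def PiE_def)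

lemma (in Module.algebra) diff_ops_minus:
  assumes P: "P \<in> diff_ops R M" and \<phi>: "\<phi> \<in> carrier M" and \<psi>: "\<psi> \<in> carrier M"
  shows "P (\<phi> \<ominus>\<^bsub>M\<^esub> \<psi>) = P \<phi> \<ominus>\<^bsub>M\<^esub> P \<psi>"
proof -
  have "P (\<ominus>\<^bsub>M\<^esub> \<psi>) = \<ominus>\<^bsub>M\<^esub> P \<psi>"
    using \<psi> diff_opsD(1,4)[OF P] by (metis R.add.inv_closed R.one_closed smult_l_minus smult_one)
  then show ?thesis
    using diff_opsD(1,3)[OF P] \<phi> \<psi> by (simp add: M.minus_eq)
qed

text \<open>The derivation part of a first order operator: what remains of \<open>P\<close> after subtracting the zeroth
  order operator of multiplication by \<open>P \<one>\<close>. It carries the principal symbol, hence the name.\<close>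

definition op_symbol :: "('f, 'm) ring_scheme \<Rightarrow> ('f \<Rightarrow> 'f) \<Rightarrow> 'f \<Rightarrow> 'f" where
  "op_symbol C P \<phi> = P \<phi> \<ominus>\<^bsub>C\<^esub> \<phi> \<otimes>\<^bsub>C\<^esub> P \<one>\<^bsub>C\<^esub>"

lemma (in Module.algebra) op_symbol_closed:
  assumes "P \<in> diff_ops R M" "\<phi> \<in> carrier M"
  shows "op_symbol M P \<phi> \<in> carrier M"
  using diff_opsD(1)[OF assms(1)] assms(2) by (simp add: op_symbol_def)

text \<open>The correction term with \<open>P \<one>\<close> is absorbed when the symbol instead of \<open>P\<close> acts on the first
  factor. This asymmetric two-term rule keeps \<open>P \<one>\<close> out of the computations below.\<close>

lemma (in Module.algebra) diff_op_mult:
  assumes P: "P \<in> diff_ops R M" and \<phi>: "\<phi> \<in> carrier M" and \<psi>: "\<psi> \<in> carrier M"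
  shows "P (\<phi> \<otimes>\<^bsub>M\<^esub> \<psi>) = op_symbol M P \<phi> \<otimes>\<^bsub>M\<^esub> \<psi> \<oplus>\<^bsub>M\<^esub> \<phi> \<otimes>\<^bsub>M\<^esub> P \<psi>"
proof -
  have "P \<phi> \<in> carrier M" "P \<psi> \<in> carrier M" "P \<one>\<^bsub>M\<^esub> \<in> carrier M"
    using diff_opsD(1)[OF P] \<phi> \<psi> by auto
  then show ?thesis
    unfolding diff_opsD(5)[OF P \<phi> \<psi>] op_symbol_def using \<phi> \<psi> by Ring.algebra
qed

text \<open>Conversely, a two-term rule with any \<open>d\<close> whatsoever suffices: putting \<open>\<psi> = \<one>\<close> forces
  \<open>d \<phi> = F \<phi> \<ominus> \<phi> \<otimes> F \<one>\<close>, and the three-term rule follows.\<close>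

lemma (in Module.algebra) diff_opsI:
  assumes F: "\<And>\<phi>. \<phi> \<in> carrier M \<Longrightarrow> F \<phi> \<in> carrier M"
    and add: "\<And>\<phi> \<psi>. \<lbrakk>\<phi> \<in> carrier M; \<psi> \<in> carrier M\<rbrakk> \<Longrightarrow> F (\<phi> \<oplus>\<^bsub>M\<^esub> \<psi>) = F \<phi> \<oplus>\<^bsub>M\<^esub> F \<psi>"
    and smult: "\<And>a \<phi>. \<lbrakk>a \<in> carrier R; \<phi> \<in> carrier M\<rbrakk> \<Longrightarrow> F (a \<odot>\<^bsub>M\<^esub> \<phi>) = a \<odot>\<^bsub>M\<^esub> F \<phi>"
    and d: "\<And>\<phi>. \<phi> \<in> carrier M \<Longrightarrow> d \<phi> \<in> carrier M"
    and mult: "\<And>\<phi> \<psi>. \<lbrakk>\<phi> \<in> carrier M; \<psi> \<in> carrier M\<rbrakk>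
      \<Longrightarrow> F (\<phi> \<otimes>\<^bsub>M\<^esub> \<psi>) = d \<phi> \<otimes>\<^bsub>M\<^esub> \<psi> \<oplus>\<^bsub>M\<^esub> \<phi> \<otimes>\<^bsub>M\<^esub> F \<psi>"
  shows "(\<lambda>\<phi>\<in>carrier M. F \<phi>) \<in> diff_ops R M"
proof -
  have "F (\<phi> \<otimes>\<^bsub>M\<^esub> \<psi>) =
       (F \<phi> \<otimes>\<^bsub>M\<^esub> \<psi> \<oplus>\<^bsub>M\<^esub> \<phi> \<otimes>\<^bsub>M\<^esub> F \<psi>) \<ominus>\<^bsub>M\<^esub> \<phi> \<otimes>\<^bsub>M\<^esub> \<psi> \<otimes>\<^bsub>M\<^esub> F \<one>\<^bsub>M\<^esub>"
    if \<phi>: "\<phi> \<in> carrier M" and \<psi>: "\<psi> \<in> carrier M" for \<phi> \<psi>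
  proof -
    have "F \<phi> = d \<phi> \<oplus>\<^bsub>M\<^esub> \<phi> \<otimes>\<^bsub>M\<^esub> F \<one>\<^bsub>M\<^esub>"
      using mult[OF \<phi> one_closed] \<phi> d by simp
    moreover have "d \<phi> \<in> carrier M" "F \<psi> \<in> carrier M" "F \<one>\<^bsub>M\<^esub> \<in> carrier M"
      using F d \<phi> \<psi> by auto
    ultimately show ?thesis
      unfolding mult[OF \<phi> \<psi>] using \<phi> \<psi> by Ring.algebra
  qed
  then show ?thesis
    using F add smult by (auto simp: diff_ops_def)
qed

text \<open>Applying the two-term rule twice, with \<open>p\<close> and \<open>q\<close> the symbols of \<open>P\<close> and \<open>Q\<close>,
  \<open>P (Q (\<phi>\<psi>)) = p (q \<phi>) \<psi> + (q \<phi> P \<psi> + p \<phi> Q \<psi>) + \<phi> P (Q \<psi>)\<close>. The middle part is symmetric in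
  \<open>P\<close> and \<open>Q\<close> and cancels in the commutator, which is left with a two-term rule whose symbol is
  the commutator of the symbols.\<close>

lemma (in Module.algebra) commutator_closed:
  assumes "P \<in> diff_ops R M" "Q \<in> diff_ops R M"
  shows "commutator M P Q \<in> diff_ops R M"
  unfolding commutator_def
proof (rule diff_opsI)
  note P = diff_opsD[OF assms(1)] and Q = diff_opsD[OF assms(2)]
  let ?p = "op_symbol M P" and ?q = "op_symbol M Q"
  note p = op_symbol_closed[OF assms(1)] and q = op_symbol_closed[OF assms(2)]
  show "P (Q (\<phi> \<oplus>\<^bsub>M\<^esub> \<psi>)) \<ominus>\<^bsub>M\<^esub> Q (P (\<phi> \<oplus>\<^bsub>M\<^esub> \<psi>)) =
    (P (Q \<phi>) \<ominus>\<^bsub>M\<^esub> Q (P \<phi>)) \<oplus>\<^bsub>M\<^esub> (P (Q \<psi>) \<ominus>\<^bsub>M\<^esub> Q (P \<psi>))"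
    if "\<phi> \<in> carrier M" "\<psi> \<in> carrier M" for \<phi> \<psi>
    using that P(1) Q(1) by (simp add: P(3) Q(3) M.minus_eq M.minus_add M.a_ac)
  show "P (Q (a \<odot>\<^bsub>M\<^esub> \<phi>)) \<ominus>\<^bsub>M\<^esub> Q (P (a \<odot>\<^bsub>M\<^esub> \<phi>)) = a \<odot>\<^bsub>M\<^esub> (P (Q \<phi>) \<ominus>\<^bsub>M\<^esub> Q (P \<phi>))"
    if "a \<in> carrier R" "\<phi> \<in> carrier M" for a \<phi>
    using that P(1) Q(1) by (simp add: P(4) Q(4) M.minus_eq smult_r_distr smult_r_minus)
  show "P (Q (\<phi> \<otimes>\<^bsub>M\<^esub> \<psi>)) \<ominus>\<^bsub>M\<^esub> Q (P (\<phi> \<otimes>\<^bsub>M\<^esub> \<psi>)) =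
      (?p (?q \<phi>) \<ominus>\<^bsub>M\<^esub> ?q (?p \<phi>)) \<otimes>\<^bsub>M\<^esub> \<psi> \<oplus>\<^bsub>M\<^esub> \<phi> \<otimes>\<^bsub>M\<^esub> (P (Q \<psi>) \<ominus>\<^bsub>M\<^esub> Q (P \<psi>))"
    if \<phi>: "\<phi> \<in> carrier M" and \<psi>: "\<psi> \<in> carrier M" for \<phi> \<psi>
  proof -
    have expand: "S (T (\<phi> \<otimes>\<^bsub>M\<^esub> \<psi>)) =
        (op_symbol M S (op_symbol M T \<phi>) \<otimes>\<^bsub>M\<^esub> \<psi> \<oplus>\<^bsub>M\<^esub> op_symbol M T \<phi> \<otimes>\<^bsub>M\<^esub> S \<psi>)
        \<oplus>\<^bsub>M\<^esub> (op_symbol M S \<phi> \<otimes>\<^bsub>M\<^esub> T \<psi> \<oplus>\<^bsub>M\<^esub> \<phi> \<otimes>\<^bsub>M\<^esub> S (T \<psi>))"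
      if S: "S \<in> diff_ops R M" and T: "T \<in> diff_ops R M" for S T
      using \<phi> \<psi> diff_opsD(1)[OF T] op_symbol_closed[OF T]
      by (simp add: diff_op_mult[OF T] diff_op_mult[OF S] diff_opsD(3)[OF S])
    have "P \<psi> \<in> carrier M" "Q \<psi> \<in> carrier M" "P (Q \<psi>) \<in> carrier M" "Q (P \<psi>) \<in> carrier M"
      "?p \<phi> \<in> carrier M" "?q \<phi> \<in> carrier M" "?p (?q \<phi>) \<in> carrier M" "?q (?p \<phi>) \<in> carrier M"
      using P(1) Q(1) p q \<phi> \<psi> by auto
    then show ?thesis
      unfolding expand[OF assms] expand[OF assms(2,1)] using \<phi> \<psi> by Ring.algebra
  qed
  show "?p (?q \<phi>) \<ominus>\<^bsub>M\<^esub> ?q (?p \<phi>) \<in> carrier M" if "\<phi> \<in> carrier M" for \<phi>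
    using that p q by simp
qed (use assms diff_opsD(1) in auto)

lemma (in Module.algebra) scaled_diff_op_closed:
  assumes "\<phi> \<in> carrier M" "P \<in> diff_ops R M"
  shows "(\<lambda>\<psi>\<in>carrier M. \<phi> \<otimes>\<^bsub>M\<^esub> P \<psi>) \<in> diff_ops R M"
proof (rule diff_opsI)
  note P = diff_opsD[OF assms(2)]
  note p = op_symbol_closed[OF assms(2)]
  show "\<phi> \<otimes>\<^bsub>M\<^esub> P (\<psi> \<oplus>\<^bsub>M\<^esub> \<theta>) = \<phi> \<otimes>\<^bsub>M\<^esub> P \<psi> \<oplus>\<^bsub>M\<^esub> \<phi> \<otimes>\<^bsub>M\<^esub> P \<theta>"
    if "\<psi> \<in> carrier M" "\<theta> \<in> carrier M" for \<psi> \<theta>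
    using that assms(1) P(1) by (simp add: P(3) r_distr)
  show "\<phi> \<otimes>\<^bsub>M\<^esub> P (a \<odot>\<^bsub>M\<^esub> \<psi>) = a \<odot>\<^bsub>M\<^esub> (\<phi> \<otimes>\<^bsub>M\<^esub> P \<psi>)"
    if "a \<in> carrier R" "\<psi> \<in> carrier M" for a \<psi>
    using that assms(1) P(1) smult_assoc2 by (simp add: P(4) m_comm[of \<phi>])
  show "\<phi> \<otimes>\<^bsub>M\<^esub> P (\<psi> \<otimes>\<^bsub>M\<^esub> \<theta>) =
      \<phi> \<otimes>\<^bsub>M\<^esub> op_symbol M P \<psi> \<otimes>\<^bsub>M\<^esub> \<theta> \<oplus>\<^bsub>M\<^esub> \<psi> \<otimes>\<^bsub>M\<^esub> (\<phi> \<otimes>\<^bsub>M\<^esub> P \<theta>)"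
    if "\<psi> \<in> carrier M" "\<theta> \<in> carrier M" for \<psi> \<theta>
    using that assms(1) P(1) p
    by (simp add: diff_op_mult[OF assms(2)] r_distr m_assoc m_lcomm[of \<phi> \<psi>])
  show "\<phi> \<otimes>\<^bsub>M\<^esub> op_symbol M P \<psi> \<in> carrier M" if "\<psi> \<in> carrier M" for \<psi>
    using that assms(1) p by simp
qed (use assms diff_opsD(1) in auto)

text \<open>Scalars act as multiplication by elements of the algebra, so the module over the scalars
  inherits closure from the module over the algebra.\<close>

lemma (in Module.algebra) smult_eq_mult:
  assumes "a \<in> carrier R" "\<phi> \<in> carrier M"
  shows "a \<odot>\<^bsub>M\<^esub> \<phi> = (a \<odot>\<^bsub>M\<^esub> \<one>\<^bsub>M\<^esub>) \<otimes>\<^bsub>M\<^esub> \<phi>"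
  using assms smult_assoc2 by simp

lemma (in Module.algebra) smult_diff_op_closed:
  assumes a: "a \<in> carrier R" and P: "P \<in> diff_ops R M"
  shows "(\<lambda>\<phi>\<in>carrier M. a \<odot>\<^bsub>M\<^esub> P \<phi>) \<in> diff_ops R M"
proof -
  have "(\<lambda>\<phi>\<in>carrier M. a \<odot>\<^bsub>M\<^esub> P \<phi>) = (\<lambda>\<phi>\<in>carrier M. (a \<odot>\<^bsub>M\<^esub> \<one>\<^bsub>M\<^esub>) \<otimes>\<^bsub>M\<^esub> P \<phi>)"
    using a diff_opsD(1)[OF P] by (intro restrict_ext smult_eq_mult)
  then show ?thesis
    using scaled_diff_op_closed[OF _ P, of "a \<odot>\<^bsub>M\<^esub> \<one>\<^bsub>M\<^esub>"] a by simp
qed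

lemma (in Module.algebra) zero_diff_op_closed:
  "(\<lambda>\<phi>\<in>carrier M. \<zero>\<^bsub>M\<^esub>) \<in> diff_ops R M"
  by (rule diff_opsI[where d = "\<lambda>_. \<zero>\<^bsub>M\<^esub>"]) auto

lemma (in Module.algebra) add_diff_ops_closed:
  assumes "P \<in> diff_ops R M" "Q \<in> diff_ops R M"
  shows "(\<lambda>\<phi>\<in>carrier M. P \<phi> \<oplus>\<^bsub>M\<^esub> Q \<phi>) \<in> diff_ops R M"
proof (rule diff_opsI)
  note P = diff_opsD[OF assms(1)] and Q = diff_opsD[OF assms(2)]
  note p = op_symbol_closed[OF assms(1)] and q = op_symbol_closed[OF assms(2)]
  show "P (\<phi> \<oplus>\<^bsub>M\<^esub> \<psi>) \<oplus>\<^bsub>M\<^esub> Q (\<phi> \<oplus>\<^bsub>M\<^esub> \<psi>) = (P \<phi> \<oplus>\<^bsub>M\<^esub> Q \<phi>) \<oplus>\<^bsub>M\<^esub> (P \<psi> \<oplus>\<^bsub>M\<^esub> Q \<psi>)"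
    if "\<phi> \<in> carrier M" "\<psi> \<in> carrier M" for \<phi> \<psi>
    using that P(1) Q(1) by (simp add: P(3) Q(3) M.a_ac)
  show "P (a \<odot>\<^bsub>M\<^esub> \<phi>) \<oplus>\<^bsub>M\<^esub> Q (a \<odot>\<^bsub>M\<^esub> \<phi>) = a \<odot>\<^bsub>M\<^esub> (P \<phi> \<oplus>\<^bsub>M\<^esub> Q \<phi>)"
    if "a \<in> carrier R" "\<phi> \<in> carrier M" for a \<phi>
    using that P(1) Q(1) by (simp add: P(4) Q(4) smult_r_distr)
  show "P (\<phi> \<otimes>\<^bsub>M\<^esub> \<psi>) \<oplus>\<^bsub>M\<^esub> Q (\<phi> \<otimes>\<^bsub>M\<^esub> \<psi>) =
      (op_symbol M P \<phi> \<oplus>\<^bsub>M\<^esub> op_symbol M Q \<phi>) \<otimes>\<^bsub>M\<^esub> \<psi> \<oplus>\<^bsub>M\<^esub> \<phi> \<otimes>\<^bsub>M\<^esub> (P \<psi> \<oplus>\<^bsub>M\<^esub> Q \<psi>)"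
    if "\<phi> \<in> carrier M" "\<psi> \<in> carrier M" for \<phi> \<psi>
    using that P(1) Q(1) p q
    by (simp add: diff_op_mult[OF assms(1)] diff_op_mult[OF assms(2)] l_distr r_distr M.a_ac)
  show "op_symbol M P \<phi> \<oplus>\<^bsub>M\<^esub> op_symbol M Q \<phi> \<in> carrier M" if "\<phi> \<in> carrier M" for \<phi>
    using that p q by simp
qed (use assms diff_opsD(1) in auto)

section \<open>The Lie algebra of first order operators\<close>

lemma (in Module.algebra) diff_op_module_is_module:
  "Module.module R (diff_op_module (module.smult M) R M)"
  (is "Module.module R ?D")
proof (rule moduleI)
    show "abelian_group ?D"
  proof (rule abelian_groupI)
    fix P assume "P \<in> carrier ?D"
    then have P: "P \<in> diff_ops R M" by (simp add: diff_op_module_def)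
    show "\<exists>Q\<in>carrier ?D. Q \<oplus>\<^bsub>?D\<^esub> P = \<zero>\<^bsub>?D\<^esub>"
    proof (intro bexI)
      let ?Q = "\<lambda>\<phi>\<in>carrier M. (\<ominus> \<one>) \<odot>\<^bsub>M\<^esub> P \<phi>"
      show "?Q \<in> carrier ?D"
        using smult_diff_op_closed[OF _ P] by (simp add: diff_op_module_def)
      show "?Q \<oplus>\<^bsub>?D\<^esub> P = \<zero>\<^bsub>?D\<^esub>"
        using diff_opsD(1)[OF P]
        by (auto simp: diff_op_module_def smult_l_minus M.l_neg cong: restrict_cong)
    qed
    show "\<zero>\<^bsub>?D\<^esub> \<oplus>\<^bsub>?D\<^esub> P = P"
      using diff_opsD(1,2)[OF P]
      by (auto simp: diff_op_module_def extensional_restrict cong: restrict_cong)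
  qed (auto simp: diff_op_module_def zero_diff_op_closed add_diff_ops_closed diff_opsD(1) M.a_ac cong: restrict_cong)
  show "\<one> \<odot>\<^bsub>?D\<^esub> P = P" if "P \<in> carrier ?D" for P
    using that diff_opsD(1,2)[of P]
    by (auto simp: diff_op_module_def extensional_restrict cong: restrict_cong)
qed (auto simp: diff_op_module_def smult_diff_op_closed diff_opsD(1) R_cring
      smult_l_distr smult_r_distr smult_assoc1 cong: restrict_cong)

text \<open>Bilinearity and the Jacobi identity hold for the commutator of any linear maps: in
  the cyclic sum each of the six threefold compositions occurs once with either sign.\<close>

lemma (in Module.algebra) commutator_lie_algebra:
  "lie_algebra R (diff_op_module (module.smult M) R M) (commutator M)"
proof -
  let ?D = "diff_op_module (module.smult M) R M"
  interpret D: Module.module R ?D by (rule diff_op_module_is_module)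
  have carr: "carrier ?D = diff_ops R M"
    and add: "(P \<oplus>\<^bsub>?D\<^esub> Q) = (\<lambda>\<phi>\<in>carrier M. P \<phi> \<oplus>\<^bsub>M\<^esub> Q \<phi>)"
    and smult: "(a \<odot>\<^bsub>?D\<^esub> Q) = (\<lambda>\<phi>\<in>carrier M. a \<odot>\<^bsub>M\<^esub> Q \<phi>)"
    and zero: "\<zero>\<^bsub>?D\<^esub> = (\<lambda>\<phi>\<in>carrier M. \<zero>\<^bsub>M\<^esub>)" for P Q a
    by (simp_all add: diff_op_module_def)
  show ?thesis
  proof unfold_locales
    fix P Q assume "P \<in> carrier ?D" "Q \<in> carrier ?D"
    then show "commutator M P Q \<in> carrier ?D"
      by (simp add: carr commutator_closed)
  next
    fix P Q S assume "P \<in> carrier ?D" "Q \<in> carrier ?D" "S \<in> carrier ?D"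
    then have P: "P \<in> diff_ops R M" and Q: "Q \<in> diff_ops R M" and S: "S \<in> diff_ops R M"
      by (simp_all add: carr)
    note [simp] = diff_opsD(1)[OF P] diff_opsD(1)[OF Q] diff_opsD(1)[OF S]
    show "commutator M (P \<oplus>\<^bsub>?D\<^esub> Q) S = commutator M P S \<oplus>\<^bsub>?D\<^esub> commutator M Q S"
      by (auto simp: commutator_def add diff_opsD(3)[OF S] M.minus_eq M.minus_add M.a_ac
          cong: restrict_cong)
    show "commutator M P (Q \<oplus>\<^bsub>?D\<^esub> S) = commutator M P Q \<oplus>\<^bsub>?D\<^esub> commutator M P S"
      by (auto simp: commutator_def add diff_opsD(3)[OF P] M.minus_eq M.minus_add M.a_ac
          cong: restrict_cong)
    have "P (Q (S \<phi>) \<ominus>\<^bsub>M\<^esub> S (Q \<phi>)) \<ominus>\<^bsub>M\<^esub> (Q (S (P \<phi>)) \<ominus>\<^bsub>M\<^esub> S (Q (P \<phi>)))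
        \<oplus>\<^bsub>M\<^esub> (Q (S (P \<phi>) \<ominus>\<^bsub>M\<^esub> P (S \<phi>)) \<ominus>\<^bsub>M\<^esub> (S (P (Q \<phi>)) \<ominus>\<^bsub>M\<^esub> P (S (Q \<phi>))))
        \<oplus>\<^bsub>M\<^esub> (S (P (Q \<phi>) \<ominus>\<^bsub>M\<^esub> Q (P \<phi>)) \<ominus>\<^bsub>M\<^esub> (P (Q (S \<phi>)) \<ominus>\<^bsub>M\<^esub> Q (P (S \<phi>)))) = \<zero>\<^bsub>M\<^esub>"
      if "\<phi> \<in> carrier M" for \<phi>
    proof -
      have "P (Q (S \<phi>)) \<in> carrier M" "P (S (Q \<phi>)) \<in> carrier M" "Q (P (S \<phi>)) \<in> carrier M"
        "Q (S (P \<phi>)) \<in> carrier M" "S (P (Q \<phi>)) \<in> carrier M" "S (Q (P \<phi>)) \<in> carrier M"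
        using that by auto
      moreover have
        "P (Q (S \<phi>) \<ominus>\<^bsub>M\<^esub> S (Q \<phi>)) = P (Q (S \<phi>)) \<ominus>\<^bsub>M\<^esub> P (S (Q \<phi>))"
        "Q (S (P \<phi>) \<ominus>\<^bsub>M\<^esub> P (S \<phi>)) = Q (S (P \<phi>)) \<ominus>\<^bsub>M\<^esub> Q (P (S \<phi>))"
        "S (P (Q \<phi>) \<ominus>\<^bsub>M\<^esub> Q (P \<phi>)) = S (P (Q \<phi>)) \<ominus>\<^bsub>M\<^esub> S (Q (P \<phi>))"
        using that by (simp_all add: diff_ops_minus[OF P] diff_ops_minus[OF Q] diff_ops_minus[OF S])
      ultimately show ?thesis
        by Ring.algebra
    qed
    then show "commutator M P (commutator M Q S) \<oplus>\<^bsub>?D\<^esub> commutator M Q (commutator M S P)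
        \<oplus>\<^bsub>?D\<^esub> commutator M S (commutator M P Q) = \<zero>\<^bsub>?D\<^esub>"
      by (simp add: commutator_def add zero cong: restrict_cong)
  next
    fix a P Q assume a: "a \<in> carrier R" and "P \<in> carrier ?D" "Q \<in> carrier ?D"
    then have P: "P \<in> diff_ops R M" and Q: "Q \<in> diff_ops R M"
      by (simp_all add: carr)
    note [simp] = diff_opsD(1)[OF P] diff_opsD(1)[OF Q]
    show "commutator M (a \<odot>\<^bsub>?D\<^esub> P) Q = a \<odot>\<^bsub>?D\<^esub> commutator M P Q"
      using a by (auto simp: commutator_def smult diff_opsD(4)[OF Q] M.minus_eq smult_r_distr
          smult_r_minus cong: restrict_cong)
    show "commutator M P (a \<odot>\<^bsub>?D\<^esub> Q) = a \<odot>\<^bsub>?D\<^esub> commutator M P Q"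
      using a by (auto simp: commutator_def smult diff_opsD(4)[OF P] M.minus_eq smult_r_distr
          smult_r_minus cong: restrict_cong)
  next
    fix P assume "P \<in> carrier ?D"
    then show "commutator M P P = \<zero>\<^bsub>?D\<^esub>"
      using diff_opsD(1)[of P] 
      by (auto simp: carr zero commutator_def M.r_neg M.minus_eq cong: restrict_cong)
  qed
qed

text \<open>Polarization: expand the vanishing bracket of \<open>x \<oplus> y\<close> with itself.\<close>

lemma (in lie_algebra) br_skew_symmetric:
  assumes x: "x \<in> carrier L" and y: "y \<in> carrier L"
  shows "br x y = \<ominus>\<^bsub>L\<^esub> br y x"
proof -
  have "\<zero>\<^bsub>L\<^esub> = br (x \<oplus>\<^bsub>L\<^esub> y) (x \<oplus>\<^bsub>L\<^esub> y)"
    by (rule br_alternating[OF M.a_closed[OF x y], symmetric])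
  also have "\<dots> = br x (x \<oplus>\<^bsub>L\<^esub> y) \<oplus>\<^bsub>L\<^esub> br y (x \<oplus>\<^bsub>L\<^esub> y)"
    by (rule br_add_left[OF x y M.a_closed[OF x y]])
  also have "\<dots> = br x y \<oplus>\<^bsub>L\<^esub> br y x"
    unfolding br_add_right[OF x x y] br_add_right[OF y x y] br_alternating[OF x] br_alternating[OF y]
    by (simp only: M.l_zero M.r_zero br_closed x y)
  finally show ?thesis
    by (rule M.minus_equality[OF sym br_closed[OF y x] br_closed[OF x y], symmetric])
qed

text \<open>This is the two-term rule for \<open>P\<close> on the product \<open>\<phi> \<otimes> Q \<psi>\<close>: the coefficient of \<open>Q\<close> in the
  formula is the symbol of \<open>P\<close> at \<open>\<phi>\<close>.\<close>

lemma (in Module.algebra) commutator_leibniz: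
  assumes \<phi>: "\<phi> \<in> carrier M" and P: "P \<in> diff_ops R M" and Q: "Q \<in> diff_ops R M"
  defines "D \<equiv> diff_op_module (monoid.mult M) R M"
  shows "commutator M P (\<phi> \<odot>\<^bsub>D\<^esub> Q) =
    (P \<phi> \<ominus>\<^bsub>M\<^esub> \<phi> \<otimes>\<^bsub>M\<^esub> P \<one>\<^bsub>M\<^esub>) \<odot>\<^bsub>D\<^esub> Q \<oplus>\<^bsub>D\<^esub> \<phi> \<odot>\<^bsub>D\<^esub> commutator M P Q"
proof -
  note [simp] = diff_opsD(1)[OF P] diff_opsD(1)[OF Q]
  have "P (\<phi> \<otimes>\<^bsub>M\<^esub> Q \<psi>) \<ominus>\<^bsub>M\<^esub> \<phi> \<otimes>\<^bsub>M\<^esub> Q (P \<psi>) =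
      op_symbol M P \<phi> \<otimes>\<^bsub>M\<^esub> Q \<psi> \<oplus>\<^bsub>M\<^esub> \<phi> \<otimes>\<^bsub>M\<^esub> (P (Q \<psi>) \<ominus>\<^bsub>M\<^esub> Q (P \<psi>))"
    if \<psi>: "\<psi> \<in> carrier M" for \<psi>
    using \<phi> \<psi> op_symbol_closed[OF P \<phi>]
    by (simp add: diff_op_mult[OF P] M.minus_eq r_distr r_minus M.a_assoc)
  then show ?thesis
    using \<phi> by (auto simp: D_def diff_op_module_def commutator_def op_symbol_def cong: restrict_cong)
qed

theorem theorem3:
  fixes n :: nat
    and T :: "'p topology"
    and \<A> :: "'p chart set"
    and \<mm> :: "'a::{comm_ring_1, real_algebra_1} set"
  assumes "smooth_manifold n T \<A>"
    and "paracompact_space T"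
    and "weil_algebra \<mm>"
  shows "let A = (ring_of_type_algebra :: 'a ring);
             C = weil_smooth_algebra n (topspace T) \<A> \<mm>;
             D = diff_op_module (module.smult C) A C;
             D\<^sub>C = diff_op_module (monoid.mult C) A C;
             br = commutator C
         in (\<forall>P\<in>carrier D. \<forall>Q\<in>carrier D. br P Q \<in> carrier D)
          \<and> (\<forall>P\<in>carrier D. \<forall>Q\<in>carrier D. br P Q = \<ominus>\<^bsub>D\<^esub> br Q P)
          \<and> lie_algebra A D br
          \<and> (\<forall>\<phi>\<in>carrier C. \<forall>P\<in>carrier D. \<forall>Q\<in>carrier D.
               br P (\<phi> \<odot>\<^bsub>D\<^sub>C\<^esub> Q) =
                 (P \<phi> \<ominus>\<^bsub>C\<^esub> \<phi> \<otimes>\<^bsub>C\<^esub> P \<one>\<^bsub>C\<^esub>) \<odot>\<^bsub>D\<^sub>C\<^esub> Q \<oplus>\<^bsub>D\<^sub>C\<^esub> \<phi> \<odot>\<^bsub>D\<^sub>C\<^esub> br P Q)"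
proof -
  let ?A = "ring_of_type_algebra :: 'a ring"
  let ?C = "weil_smooth_algebra n (topspace T) \<A> \<mm>"
  let ?D = "diff_op_module (module.smult ?C) ?A ?C"
  have charts: "charts_in (topspace T) \<A>"
    using assms(1) openin_subset unfolding smooth_manifold_def charts_in_def by fast
  obtain B :: "'a set" where B: "finite B" "span B = UNIV"
    using assms(3) by (auto simp: weil_algebra_def)
  note bundle_charts = weil_charts_in[OF charts, of n \<mm>]
  have alg: "Module.algebra ?A ?C"
    unfolding weil_smooth_algebra_def weil_smooth_functions_eq
  proof (rule algebra_pointwise)
    show "smooth_vector_functions m N \<B> \<subseteq> extensional N" for m N and \<B> :: "'q chart set"
      by (auto simp: smooth_vector_functions_def)
  qed (intro smooth_vector_functions_const smooth_vector_functions_add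
      smooth_vector_functions_mult[OF _ B] bundle_charts; assumption)+
  have carrier: "carrier (diff_op_module act ?A ?C) = diff_ops ?A ?C" for act :: "'s \<Rightarrow> _"
    by (simp add: diff_op_module_def)
  have lie: "lie_algebra ?A ?D (commutator ?C)"
    by (rule algebra.commutator_lie_algebra[OF alg])
  show ?thesis
    unfolding Let_def
  proof (intro conjI ballI)
    show "lie_algebra ?A ?D (commutator ?C)" by (rule lie)
  next
    fix P Q assume PQ: "P \<in> carrier ?D" "Q \<in> carrier ?D"
    show "commutator ?C P Q \<in> carrier ?D"
      by (rule lie_algebra.br_closed[OF lie PQ])
    show "commutator ?C P Q = \<ominus>\<^bsub>?D\<^esub> commutator ?C Q P"
      by (rule lie_algebra.br_skew_symmetric[OF lie PQ])
  next
    let ?D\<^sub>C = "diff_op_module (monoid.mult ?C) ?A ?C"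
    fix \<phi> P Q assume "\<phi> \<in> carrier ?C" "P \<in> carrier ?D" "Q \<in> carrier ?D"
    then show "commutator ?C P (\<phi> \<odot>\<^bsub>?D\<^sub>C\<^esub> Q) =
        (P \<phi> \<ominus>\<^bsub>?C\<^esub> \<phi> \<otimes>\<^bsub>?C\<^esub> P \<one>\<^bsub>?C\<^esub>) \<odot>\<^bsub>?D\<^sub>C\<^esub> Q \<oplus>\<^bsub>?D\<^sub>C\<^esub> \<phi> \<odot>\<^bsub>?D\<^sub>C\<^esub> commutator ?C P Q"
      unfolding carrier by (rule algebra.commutator_leibniz[OF alg])
  qed
qed

end
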